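(* Suppose that $$0<\beta<\frac{\pi}{2},\qquad 0<\gamma<\beta,\qquad \lambda_1:=\kappa\big(\cos\gamma\,\tilde I(\gamma)-\gamma\,\mathrm{Lip}^*I\big)>0,$$ and let $\mathbf R=\{R_i\}_{i=1}^N$ and $\mathbf S=\{S_i\}_{i=1}^N$ be global solutions to the Winfree matrix model on $SO(n)$ (see context), with the same $\Omega_i$, $\kappa$ and $I$, and with initial data $\mathbf R^0=\{R_i^0\}_{i=1}^N$ and $\mathbf S^0=\{S_i^0\}_{i=1}^N$ respectively, such that $$R_i(t)\in\overline{B_\gamma},\quad S_i(t)\in\overline{B_\gamma}\qquad\text{for all } t\ge0,\ i\in[N].$$ Then $$\|\mathbf R(t)-\mathbf S(t)\|_{\ell^1}\le e^{-\lambda_1t}\,\|\mathbf R^0-\mathbf S^0\|_{\ell^1},\qquad t\ge0.$$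
   Context: Let $[N]=\{1,\dots,N\}$, let $I_n$ be the $n\times n$ identity matrix, and let $\mathfrak{so}(n)$ be the space of real skew-symmetric $n\times n$ matrices. On $\mathbb{R}^{n\times n}$ use $\langle A,B\rangle=\frac12\operatorname{tr}(A^TB)$ and $\|A\|=\sqrt{\langle A,A\rangle}$; for $\mathbf R=(R_1,\dots,R_N)\in(\mathbb{R}^{n\times n})^N$ put $\|\mathbf R\|_{\ell^1}=\sum_{i=1}^N\|R_i\|$. Let $d$ be the geodesic (Riemannian) distance on $SO(n)$ for the metric $\langle\cdot,\cdot\rangle$ restricted to tangent spaces; if $R\in SO(n)$ has eigenvalues $e^{\pm \mathrm{i}\theta_1},\dots,e^{\pm\mathrm{i}\theta_m},1,\dots,1$ with $\theta_j\in(0,\pi]$, then $d(I_n,R)=\sqrt{\sum_j\theta_j^2}$. Put $\overline{B_r}=\{R\in SO(n): d(I_n,R)\le r\}$. The Winfree matrix model on $SO(n)$ is $$\dot R_i=\Omega_iR_i+\frac{\kappa}{2}\Big(\frac1N\sum_{j=1}^N I(R_j)\Big)(I_n-R_i^2),\quad t>0,\qquad R_i(0)=R_i^0\in SO(n),\quad i\in[N],$$ with $\Omega_i\in\mathfrak{so}(n)$ and $\kappa>0$. Standing assumptions on the influence function $I$: $I(R)=\tilde I(d(I_n,R))$ for a function $\tilde I:[0,\lfloor n/2\rfloor\pi]\to\mathbb{R}_{\ge0}$ that is decreasing (non-increasing), satisfies $\lim_{r\to0^+}\tilde I(r)=1$, is globally Lipschitz continuous, and has support $\operatorname{supp}\tilde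 I=[0,\beta]$ with $0<\beta<\frac{\pi}{2}$. Moreover $$\mathrm{Lip}^*I:=\sup_{X,Y\in SO(n),\,X\ne Y}\frac{|I(X)-I(Y)|}{\|X-Y\|}.$$ *)

theory Defs
  imports "HOL-Analysis.Analysis"
begin

definition SO :: "(real^'n^'n) set" where
  "SO = {R. orthogonal_matrix R \<and> det R = 1}"

definition so :: "(real^'n^'n) set" where
  "so = {A. transpose A = - A}"

(* The norm on matrices is not the library's "norm", which is the Frobenius norm and hence
   larger by the factor sqrt 2. *)

definition mat_inner :: "real^'n^'n \<Rightarrow> real^'n^'n \<Rightarrow> real" where
  "mat_inner A B = 1/2 * trace (transpose A ** B)"

definition mat_norm :: "real^'n^'n \<Rightarrow> real" where
  "mat_norm A = sqrt (mat_inner A A)"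

definition ell1_norm :: "nat \<Rightarrow> (nat \<Rightarrow> real^'n^'n) \<Rightarrow> real" where
  "ell1_norm N A = (\<Sum>i=1..N. mat_norm (A i))"

(* Lengths of the piecewise C1 curves in SO(n) from X to Y.  A "valid_path" may have an unbounded
   derivative near its finitely many exceptional points; "has_integral" discards curves whose
   speed is not integrable, for which "integral" would return the junk value 0. *)

definition curve_lengths :: "real^'n^'n \<Rightarrow> real^'n^'n \<Rightarrow> real set" where
  "curve_lengths X Y =
     {L. \<exists>g. valid_path g \<and> path_image g \<subseteq> SO \<and> pathstart g = X \<and> pathfinish g = Y \<and>
             ((\<lambda>t. mat_norm (vector_derivative g (at t))) has_integral L) {0..1}}"

definition geodesic_dist :: "real^'n^'n \<Rightarrow> real^'n^'n \<Rightarrow> ereal" where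
  "geodesic_dist X Y = Inf (ereal ` curve_lengths X Y)"

definition closed_geodesic_ball :: "real \<Rightarrow> (real^'n^'n) set" where
  "closed_geodesic_ball r = {R \<in> SO. geodesic_dist (mat 1) R \<le> ereal r}"

(* The profile I~ is a function on [0, floor(n/2) pi]; its values elsewhere are irrelevant.
   SO(n) is connected, so on it geodesic_dist is finite and real_of_ereal loses nothing. *)

definition influence_profile :: "nat \<Rightarrow> real \<Rightarrow> (real \<Rightarrow> real) \<Rightarrow> bool" where
  "influence_profile n \<beta> Itilde \<longleftrightarrow>
     (let dom = {0..real (n div 2) * pi} in
        (\<forall>r\<in>dom. 0 \<le> Itilde r) \<and>
        antimono_on dom Itilde \<and>
        (Itilde \<longlongrightarrow> 1) (at_right 0) \<and>
        (\<exists>L. L-lipschitz_on dom Itilde) \<and>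
        closure {r\<in>dom. Itilde r \<noteq> 0} = {0..\<beta>})"

definition influence :: "(real \<Rightarrow> real) \<Rightarrow> real^'n^'n \<Rightarrow> real" where
  "influence Itilde R = Itilde (real_of_ereal (geodesic_dist (mat 1) R))"

definition Lip_star :: "(real^'n^'n \<Rightarrow> real) \<Rightarrow> ereal" where
  "Lip_star I =
     Sup {ereal (\<bar>I X - I Y\<bar> / mat_norm (X - Y)) | X Y. X \<in> SO \<and> Y \<in> SO \<and> X \<noteq> Y}"

definition winfree_solution ::
  "nat \<Rightarrow> (nat \<Rightarrow> real^'n^'n) \<Rightarrow> real \<Rightarrow> (real^'n^'n \<Rightarrow> real) \<Rightarrow> (nat \<Rightarrow> real^'n^'n) \<Rightarrow>
   (nat \<Rightarrow> real \<Rightarrow> real^'n^'n) \<Rightarrow> bool"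
where
  "winfree_solution N \<Omega> \<kappa> I R0 R \<longleftrightarrow>
     (\<forall>i\<in>{1..N}.
        R i 0 = R0 i \<and>
        (\<forall>t\<ge>0. R i t \<in> SO) \<and>
        continuous_on {0..} (R i) \<and>
        (\<forall>t>0. (R i has_vector_derivative
           (\<Omega> i ** R i t +
            (\<kappa> / 2 * (1 / real N * (\<Sum>j=1..N. I (R j t)))) *\<^sub>R (mat 1 - R i t ** R i t)))
           (at t)))"

end

theory Submission
  imports Defs
begin

text \<open>
  Let \<open>D = X - Y\<close> be the difference of corresponding components of the two solutions.  The skew term
  \<open>\<Omega>\<close> does not contribute to \<open>\<langle>D, D'\<rangle>\<close>.  Since \<open>X\<^sup>2 - Y\<^sup>2 = X D + D Y\<close> and the symmetric parts of matrices
  in the ball are at least \<open>cos \<gamma>\<close>, the quadratic terms contract \<open>\<parallel>D\<parallel>\<close> at rate \<open>\<kappa> cos \<gamma> I(\<gamma>)\<close>.  The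
  difference of the mean influences is multiplied by \<open>\<parallel>I - Y\<^sup>2\<parallel> = \<parallel>Y - Y\<^sup>T\<parallel> \<le> 2 \<gamma>\<close>, and summing over all
  components gives growth at a rate of at most \<open>\<kappa> \<gamma> Lip\<close>.  Both bounds on the ball are obtained by
  following a curve from the identity, so that no matrix exponential or spectral theory is needed.
\<close>

section \<open>Frobenius inner products, columns and orthogonal factors\<close>

lemma inner_matrix_eq_columns:
  fixes A B :: "real^'m^'n"
  shows "A \<bullet> B = (\<Sum>j\<in>UNIV. column j A \<bullet> column j B)"
  unfolding inner_vec_def column_def by (simp, rule sum.swap)

lemma column_matrix_mult:
  fixes A :: "'a::semiring_1^'m^'n"
  shows "column j (A ** B) = A *v column j B"
  by (simp add: vec_eq_iff column_def matrix_matrix_mult_def matrix_vector_mult_def)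

lemma inner_transpose:
  fixes A B :: "real^'m^'n"
  shows "transpose A \<bullet> transpose B = A \<bullet> B"
  unfolding inner_vec_def transpose_def by (simp, rule sum.swap)

lemma norm_transpose [simp]:
  fixes A :: "real^'m^'n"
  shows "norm (transpose A) = norm A"
  by (simp add: norm_eq_sqrt_inner inner_transpose)

lemma inner_matrix_vector_left:
  fixes A :: "real^'m^'n"
  shows "(A *v v) \<bullet> w = v \<bullet> (transpose A *v w)"
  by (metis dot_lmul_matrix inner_commute transpose_matrix_vector)

lemma matrix_mult_diff_distrib:
  fixes A B C :: "real^'n^'n"
  shows "A ** (B - C) = A ** B - A ** C" "(A - B) ** C = A ** C - B ** C"
  by (simp_all add: vec_eq_iff matrix_matrix_mult_def algebra_simps sum_subtractf)

lemma mat_inner_eq: "mat_inner A B = (A \<bullet> B) / 2"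
proof -
  have "trace (transpose A ** B) = A \<bullet> B"
    unfolding trace_def matrix_matrix_mult_def transpose_def inner_vec_def
    by (simp, rule sum.swap)
  then show ?thesis by (simp add: mat_inner_def)
qed

lemma mat_norm_eq: "mat_norm A = norm A / sqrt 2"
  by (simp add: mat_norm_def mat_inner_eq real_sqrt_divide norm_eq_sqrt_inner)

lemma mat_norm_nonneg [simp]: "0 \<le> mat_norm A"
  by (simp add: mat_norm_eq)

lemma orthogonal_matrix_inner:
  fixes Q :: "real^'n^'n"
  assumes "orthogonal_matrix Q"
  shows "(Q *v v) \<bullet> (Q *v w) = v \<bullet> w"
  using assms by (simp add: inner_matrix_vector_left matrix_vector_mul_assoc orthogonal_matrix
      del: transpose_matrix_vector)

lemma norm_orthogonal_matrix_mult:
  fixes Q A :: "real^'n^'n"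
  assumes "orthogonal_matrix Q"
  shows "norm (Q ** A) = norm A"
  by (simp add: norm_eq_sqrt_inner inner_matrix_eq_columns column_matrix_mult
      orthogonal_matrix_inner[OF assms])

text \<open>\<open>X\<close> acts on each column of \<open>D\<close> separately, so the bound on its
  quadratic form is summed over the columns.\<close>

lemma inner_mult_left_ge:
  fixes X D :: "real^'n^'n"
  assumes "\<And>v. c * (v \<bullet> v) \<le> v \<bullet> (X *v v)"
  shows "c * (D \<bullet> D) \<le> D \<bullet> (X ** D)"
  by (simp add: inner_matrix_eq_columns column_matrix_mult sum_distrib_left sum_mono assms)

text \<open>Transposition preserves the Frobenius product and the quadratic form of
  \<open>Y\<close>, and it turns right multiplication into left multiplication.\<close>

lemma inner_mult_right_ge:
  fixes Y D :: "real^'n^'n"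
  assumes "\<And>v. c * (v \<bullet> v) \<le> v \<bullet> (Y *v v)"
  shows "c * (D \<bullet> D) \<le> D \<bullet> (D ** Y)"
proof -
  have "c * (v \<bullet> v) \<le> v \<bullet> (transpose Y *v v)" for v
    using assms[of v] inner_matrix_vector_left[of Y v v] by (metis inner_commute)
  from inner_mult_left_ge[OF this, of "transpose D"] show ?thesis
    by (simp add: inner_transpose flip: matrix_transpose_mul)
qed

text \<open>The quadratic form of a skew matrix vanishes, hence so does the contribution of each
  column of \<open>D\<close>.\<close>

lemma inner_skew_mult:
  fixes A D :: "real^'n^'n"
  assumes "transpose A = - A"
  shows "D \<bullet> (A ** D) = 0"
proof -
  have "v \<bullet> (A *v v) = 0" for v
  proof -
    have "- A *v v = - (A *v v)"
      by (simp add: vec_eq_iff matrix_vector_mult_def sum_negf)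
    then have "(A *v v) \<bullet> v = - (v \<bullet> (A *v v))"
      using inner_matrix_vector_left[of A v v] assms by simp
    then show ?thesis by (simp add: inner_commute)
  qed
  then show ?thesis by (simp add: inner_matrix_eq_columns column_matrix_mult)
qed

text \<open>The matrix on the left is \<open>Y ** (transpose Y - Y)\<close>, and an orthogonal
  factor preserves the Frobenius norm.\<close>

lemma norm_mat_1_minus_square:
  fixes Y :: "real^'n^'n"
  assumes "orthogonal_matrix Y"
  shows "norm (mat 1 - Y ** Y) = norm (Y - transpose Y)"
proof -
  have "Y ** (transpose Y - Y) = mat 1 - Y ** Y"
    using assms by (simp add: orthogonal_matrix_def matrix_mult_diff_distrib)
  then show ?thesis
    using norm_orthogonal_matrix_mult[OF assms, of "transpose Y - Y"]
    by (simp add: norm_minus_commute)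
qed

text \<open>Bessel's inequality for the orthonormal pair \<open>v\<close>, \<open>w\<close>, applied
  to each row of \<open>A\<close>.\<close>

lemma norm_matrix_ge_orthonormal_pair:
  fixes A :: "real^'m^'n"
  assumes "norm v = 1" "norm w = 1" "v \<bullet> w = 0"
  shows "(norm (A *v v))\<^sup>2 + (norm (A *v w))\<^sup>2 \<le> (norm A)\<^sup>2"
proof -
  have bessel: "(r \<bullet> v)\<^sup>2 + (r \<bullet> w)\<^sup>2 \<le> r \<bullet> r" for r
  proof -
    have "v \<bullet> v = 1" "w \<bullet> w = 1" "w \<bullet> v = 0"
      using assms by (simp_all add: dot_square_norm inner_commute)
    then have "(r - (r \<bullet> v) *\<^sub>R v - (r \<bullet> w) *\<^sub>R w) \<bullet> (r - (r \<bullet> v) *\<^sub>R v - (r \<bullet> w) *\<^sub>R w)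
        = r \<bullet> r - (r \<bullet> v)\<^sup>2 - (r \<bullet> w)\<^sup>2"
      using assms(3)
      by (simp add: inner_diff_left inner_diff_right power2_eq_square inner_commute[of v r]
          inner_commute[of w r])
    then show ?thesis
      using inner_ge_zero[of "r - (r \<bullet> v) *\<^sub>R v - (r \<bullet> w) *\<^sub>R w"] by linarith
  qed
  have "(norm (A *v v))\<^sup>2 + (norm (A *v w))\<^sup>2 = (\<Sum>i\<in>UNIV. (A $ i \<bullet> v)\<^sup>2 + (A $ i \<bullet> w)\<^sup>2)"
    by (simp only: power2_norm_eq_inner)
      (simp add: inner_vec_def[of "A *v _"] matrix_vector_mul_component sum.distrib power2_eq_square)
  also have "\<dots> \<le> (\<Sum>i\<in>UNIV. A $ i \<bullet> A $ i)"
    by (intro sum_mono bessel)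
  also have "\<dots> = (norm A)\<^sup>2"
    by (simp only: power2_norm_eq_inner inner_vec_def[of A])
  finally show ?thesis .
qed

section \<open>Increments of curves and tangent vectors of the orthogonal group\<close>

text \<open>Fundamental theorem of calculus with finitely many exceptional times. The bound
  \<open>s\<close> is kept apart from \<open>h'\<close> so that one length integral can control
  several functions of the same curve.\<close>

lemma increment_le_length:
  fixes h :: "real \<Rightarrow> 'a::banach"
  assumes "finite K" "continuous_on {0..1} h"
    and "\<And>t. t \<in> {0<..<1} - K \<Longrightarrow> (h has_vector_derivative h' t) (at t)"
    and "\<And>t. t \<in> {0<..<1} - K \<Longrightarrow> norm (h' t) \<le> s t"
    and "(s has_integral L) {0..1}"
  shows "norm (h 1 - h 0) \<le> L"
proof -
  define K' where "K' = insert 0 (insert 1 K)"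
  have fin: "finite K'" by (simp add: K'_def assms)
  have "(h' has_integral (h 1 - h 0)) {0..1}"
    by (rule fundamental_theorem_of_calculus_interior_strong[OF assms(1)]) (use assms in auto)
  \<comment> \<open>At the end points and on \<open>K\<close> nothing is known about
    \<open>h'\<close> and \<open>s\<close>; both integrands are set to 0 there, which leaves the
    integrals unchanged.\<close>
  then have h: "((\<lambda>t. if t \<in> K' then 0 else h' t) has_integral (h 1 - h 0)) {0..1}"
    by (rule has_integral_spike_finite[OF fin, rotated]) auto
  have s: "((\<lambda>t. if t \<in> K' then 0 else s t) has_integral L) {0..1}"
    by (rule has_integral_spike_finite[OF fin _ assms(5)]) auto
  have "norm (integral {0..1} (\<lambda>t. if t \<in> K' then 0 else h' t))
      \<le> integral {0..1} (\<lambda>t. if t \<in> K' then 0 else s t)"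
    by (rule integral_norm_bound_integral)
      (use h s assms(4) in \<open>auto simp: K'_def has_integral_integrable\<close>)
  then show ?thesis
    using h s by (simp add: integral_unique)
qed

lemma bounded_linear_matrix_vector_mult_left: "bounded_linear (\<lambda>A :: real^'m^'n. A *v v)"
  by (intro linear_conv_bounded_linear[THEN iffD1] linearI)
    (simp_all add: matrix_vector_mult_add_rdistrib scaleR_matrix_vector_assoc)

lemma bounded_linear_transpose: "bounded_linear (transpose :: real^'m^'n \<Rightarrow> _)"
  by (intro linear_conv_bounded_linear[THEN iffD1] linearI)
    (simp_all add: transpose_def vec_eq_iff)

text \<open>Near \<open>t\<close> the product \<open>(g s *v v) \<bullet> (g s *v w)\<close> is
  constant by orthogonality; its derivative says that \<open>transpose (g t) ** D\<close> is
  skew.\<close>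

lemma orthogonal_matrix_tangent:
  fixes g :: "real \<Rightarrow> real^'n^'n"
  assumes g: "(g has_vector_derivative D) (at t)"
    and "open U" "t \<in> U" and orth: "\<And>s. s \<in> U \<Longrightarrow> orthogonal_matrix (g s)"
  shows "(D *v v) \<bullet> (g t *v w) + (g t *v v) \<bullet> (D *v w) = 0"
proof -
  note d = bounded_linear.has_vector_derivative[OF bounded_linear_matrix_vector_mult_left g]
  have "((\<lambda>s. (g s *v v) \<bullet> (g s *v w)) has_vector_derivative
      (g t *v v) \<bullet> (D *v w) + (D *v v) \<bullet> (g t *v w)) (at t)"
    by (rule bounded_bilinear.has_vector_derivative[OF bounded_bilinear_inner d d])
  moreover have "((\<lambda>s. (g s *v v) \<bullet> (g s *v w)) has_vector_derivative 0) (at t)"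
    by (rule has_vector_derivative_transform_within_open[OF _ \<open>open U\<close> \<open>t \<in> U\<close>,
          where f = "\<lambda>_. v \<bullet> w"])
      (auto simp: orth orthogonal_matrix_inner)
  ultimately have "(g t *v v) \<bullet> (D *v w) + (D *v v) \<bullet> (g t *v w) = 0"
    by (rule vector_derivative_unique_at)
  then show ?thesis by simp
qed

text \<open>\<open>Q\<^sup>T D\<close> is skew, so its nonzero singular values occur in pairs, and the operator norm is at most
  the Frobenius norm divided by \<open>sqrt 2\<close>.\<close>

lemma norm_orthogonal_tangent_mult_le:
  fixes Q D :: "real^'n^'n"
  assumes Q: "orthogonal_matrix Q"
    and tangent: "\<And>v w. (D *v v) \<bullet> (Q *v w) + (Q *v v) \<bullet> (D *v w) = 0"
    and v: "norm v = 1"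
  shows "norm (D *v v) \<le> mat_norm D"
proof (cases "D *v v = 0")
  case True
  then show ?thesis by (simp add: mat_norm_eq)
next
  case False
  define a where "a = D *v v"
  define u where "u = a /\<^sub>R norm a"
  \<comment> \<open>\<open>w\<close> is the preimage under \<open>Q\<close> of the direction of
    \<open>D *v v\<close>. Tangency tested on \<open>v\<close>, \<open>v\<close> makes
    \<open>w\<close> orthogonal to \<open>v\<close>; tested on \<open>v\<close>, \<open>w\<close> it
    shows that \<open>D\<close> stretches \<open>w\<close> at least as much as
    \<open>v\<close>.\<close>
  define w where "w = transpose Q *v u"
  have a: "norm a > 0" using False by (simp add: a_def)
  have u: "norm u = 1" "a \<bullet> u = norm a"
    using a by (simp_all add: u_def dot_square_norm power2_eq_square)
  have Qw: "Q *v w = u"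
    using Q by (simp add: w_def matrix_vector_mul_assoc orthogonal_matrix_def
        del: transpose_matrix_vector)
  have "norm w = 1"
    using orthogonal_matrix_inner[OF Q, of w w] u Qw by (simp add: norm_eq_sqrt_inner)
  moreover have "v \<bullet> w = 0"
  proof -
    have "a \<bullet> (Q *v v) = 0"
      using tangent[of v v] by (simp add: a_def inner_commute)
    then have "(Q *v v) \<bullet> u = 0" by (simp add: u_def inner_commute)
    then show ?thesis using orthogonal_matrix_inner[OF Q, of v w] Qw by simp
  qed
  ultimately have le: "(norm a)\<^sup>2 + (norm (D *v w))\<^sup>2 \<le> (norm D)\<^sup>2"
    unfolding a_def using norm_matrix_ge_orthonormal_pair v by blast
  have "(Q *v v) \<bullet> (D *v w) = - norm a"
    using tangent[of v w] Qw u by (simp add: a_def)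
  moreover have "norm (Q *v v) = 1"
    using orthogonal_matrix_inner[OF Q, of v v] v by (simp add: norm_eq_sqrt_inner)
  ultimately have "norm a \<le> norm (D *v w)"
    using Cauchy_Schwarz_ineq2[of "Q *v v" "D *v w"] by simp
  then have "(norm a)\<^sup>2 \<le> (norm (D *v w))\<^sup>2" by (simp add: power_mono)
  moreover have "(norm a * sqrt 2)\<^sup>2 = (norm a)\<^sup>2 + (norm a)\<^sup>2"
    by (simp add: power_mult_distrib)
  ultimately have "(norm a * sqrt 2)\<^sup>2 \<le> (norm D)\<^sup>2"
    using le by linarith
  then have "norm a * sqrt 2 \<le> norm D" using norm_ge_zero power2_le_imp_le by blast
  then show ?thesis by (simp add: a_def mat_norm_eq field_simps)
qed

text \<open>Only the component of \<open>v\<close> orthogonal to \<open>p\<close> pairs with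
  \<open>q\<close>; the square root is its length, the sine of the angle between \<open>v\<close>
  and \<open>p\<close>.\<close>

lemma abs_inner_tangent_le:
  fixes v p q :: "'a::real_inner"
  assumes "norm v = 1" "norm p = 1" "q \<bullet> p = 0"
  shows "\<bar>v \<bullet> q\<bar> \<le> sqrt (1 - (v \<bullet> p)\<^sup>2) * norm q"
proof -
  have "(v - (v \<bullet> p) *\<^sub>R p) \<bullet> (v - (v \<bullet> p) *\<^sub>R p) = 1 - (v \<bullet> p)\<^sup>2"
  proof -
    have "v \<bullet> v = 1" "p \<bullet> p = 1"
      using assms by (simp_all add: dot_square_norm)
    then show ?thesis
      by (simp add: inner_diff_left inner_diff_right inner_commute[of p v] power2_eq_square)
  qed
  then have "norm (v - (v \<bullet> p) *\<^sub>R p) = sqrt (1 - (v \<bullet> p)\<^sup>2)"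
    by (simp add: norm_eq_sqrt_inner)
  moreover have "v \<bullet> q = (v - (v \<bullet> p) *\<^sub>R p) \<bullet> q"
    using assms(3) by (simp add: inner_diff_left inner_commute[of p q])
  ultimately show ?thesis by (metis Cauchy_Schwarz_ineq2)
qed

section \<open>Estimates along a curve from the identity\<close>

text \<open>Unpacks a curve into an explicit velocity \<open>D\<close>, a true derivative at
  interior times off \<open>K\<close>; the finitely many other values do not affect the
  integral.\<close>

lemma curve_lengthsE:
  fixes R :: "real^'n^'n"
  assumes "L \<in> curve_lengths (mat 1) R"
  obtains g D K where "continuous_on {0..1} g" "g 0 = mat 1" "g 1 = R" "finite K"
    "\<And>t. t \<in> {0..1} \<Longrightarrow> orthogonal_matrix (g t)"
    "\<And>t. t \<in> {0<..<1} - K \<Longrightarrow> (g has_vector_derivative D t) (at t)"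
    "((\<lambda>t. mat_norm (D t)) has_integral L) {0..1}"
proof -
  from assms obtain g where g: "valid_path g" "path_image g \<subseteq> SO" "pathstart g = mat 1"
      "pathfinish g = R"
      and int: "((\<lambda>t. mat_norm (vector_derivative g (at t))) has_integral L) {0..1}"
    unfolding curve_lengths_def by blast
  from g(1) obtain K where cont: "continuous_on {0..1} g" and K: "finite K"
      "g C1_differentiable_on {0..1} - K"
    unfolding valid_path_def piecewise_C1_differentiable_on_def by blast
  have "(g has_vector_derivative vector_derivative g (at t)) (at t)" if "t \<in> {0<..<1} - K" for t
    using K(2) that unfolding C1_differentiable_on_eq
    by (auto simp: vector_derivative_works)
  moreover have "orthogonal_matrix (g t)" if "t \<in> {0..1}" for t
    using g(2) that unfolding path_image_def SO_def by blast
  ultimately show ?thesis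
    using that[of g K "\<lambda>t. vector_derivative g (at t)"] cont K g int
    by (simp add: pathstart_def pathfinish_def)
qed

text \<open>The difference of \<open>g t\<close> and its transpose vanishes at the identity and
  changes at speed at most \<open>2 * norm (D t)\<close>, which is
  \<open>2 * sqrt 2 * mat_norm (D t)\<close>.\<close>

lemma norm_skew_part_le_curve_length:
  fixes R :: "real^'n^'n"
  assumes "L \<in> curve_lengths (mat 1) R"
  shows "norm (R - transpose R) \<le> 2 * sqrt 2 * L"
proof -
  from assms obtain g D K where g: "continuous_on {0..1} g" "g 0 = mat 1" "g 1 = R" "finite K"
    and der: "\<And>t. t \<in> {0<..<1} - K \<Longrightarrow> (g has_vector_derivative D t) (at t)"
    and int: "((\<lambda>t. mat_norm (D t)) has_integral L) {0..1}"
    by (rule curve_lengthsE) blast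
  have "norm ((g 1 - transpose (g 1)) - (g 0 - transpose (g 0))) \<le> 2 * sqrt 2 * L"
  proof (rule increment_le_length[OF g(4), where h' = "\<lambda>t. D t - transpose (D t)"])
    show "continuous_on {0..1} (\<lambda>t. g t - transpose (g t))"
      by (intro continuous_on_diff g(1) bounded_linear.continuous_on[OF bounded_linear_transpose])
    show "((\<lambda>t. g t - transpose (g t)) has_vector_derivative D t - transpose (D t)) (at t)"
      if "t \<in> {0<..<1} - K" for t
      by (intro has_vector_derivative_diff der that
          bounded_linear.has_vector_derivative[OF bounded_linear_transpose])
    show "norm (D t - transpose (D t)) \<le> 2 * sqrt 2 * mat_norm (D t)" for t
      using norm_triangle_ineq4[of "D t" "transpose (D t)"] by (simp add: mat_norm_eq)
    show "((\<lambda>t. 2 * sqrt 2 * mat_norm (D t)) has_integral 2 * sqrt 2 * L) {0..1}"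
      by (rule has_integral_mult_right[OF int])
  qed
  then show ?thesis using g by simp
qed

text \<open>The curve \<open>t \<mapsto> g(t) v\<close> on the unit sphere is at least as long as the angle between its end
  points.  Shrinking the cosine by a factor \<open>c < 1\<close> keeps it away from the singularities of
  \<open>arccos\<close>.\<close>

lemma arccos_le_curve_length:
  fixes R :: "real^'n^'n"
  assumes "L \<in> curve_lengths (mat 1) R" and v: "norm v = 1"
  shows "arccos (v \<bullet> (R *v v)) \<le> L"
proof -
  from assms(1) obtain g D K where g: "continuous_on {0..1} g" "g 0 = mat 1" "g 1 = R" "finite K"
    and orth: "\<And>t. t \<in> {0..1} \<Longrightarrow> orthogonal_matrix (g t)"
    and der: "\<And>t. t \<in> {0<..<1} - K \<Longrightarrow> (g has_vector_derivative D t) (at t)"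
    and int: "((\<lambda>t. mat_norm (D t)) has_integral L) {0..1}"
    by (rule curve_lengthsE) blast
  \<comment> \<open>The cosine of the angle between \<open>v\<close> and its image under
    \<open>g t\<close>.\<close>
  define f where "f t = v \<bullet> (g t *v v)" for t
  have unit: "norm (g t *v v) = 1" if "t \<in> {0..1}" for t
    using orthogonal_matrix_inner[OF orth[OF that], of v v] v by (simp add: norm_eq_sqrt_inner)
  have f_le: "\<bar>f t\<bar> \<le> 1" if "t \<in> {0..1}" for t
    using Cauchy_Schwarz_ineq2[of v "g t *v v"] unit[OF that] v by (simp add: f_def)
  have f_cont: "continuous_on {0..1} f"
    unfolding f_def
    by (intro continuous_on_inner continuous_on_const g(1)
        bounded_linear.continuous_on[OF bounded_linear_matrix_vector_mult_left])
  have approx: "arccos (c * f 1) - arccos c \<le> L" if c: "0 < c" "c < 1" for c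
  proof -
    have cf: "\<bar>c * f t\<bar> < 1" if "t \<in> {0..1}" for t
    proof -
      have "c * \<bar>f t\<bar> \<le> c * 1" using f_le[OF that] c by (intro mult_left_mono) auto
      moreover have "\<bar>c * f t\<bar> = c * \<bar>f t\<bar>" using c by (simp add: abs_mult)
      ultimately show ?thesis using c by linarith
    qed
    have "norm (arccos (c * f 1) - arccos (c * f 0)) \<le> L"
    proof (rule increment_le_length[OF g(4) _ _ _ int, where h = "\<lambda>t. arccos (c * f t)"
          and h' = "\<lambda>t. inverse (- sqrt (1 - (c * f t)\<^sup>2)) * (c * (v \<bullet> (D t *v v)))"])
      have "-1 \<le> c * f t \<and> c * f t \<le> 1" if "t \<in> {0..1}" for t
        using cf[OF that] by linarith
      then show "continuous_on {0..1} (\<lambda>t. arccos (c * f t))"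
        by (intro continuous_on_arccos continuous_on_mult continuous_on_const f_cont) blast
    next
      fix t assume t: "t \<in> {0<..<1} - K"
      then have t01: "t \<in> {0..1}" by auto
      have "(f has_real_derivative v \<bullet> (D t *v v)) (at t)"
        unfolding f_def has_real_derivative_iff_has_vector_derivative
        by (intro bounded_linear.has_vector_derivative[OF bounded_linear_inner_right]
            bounded_linear.has_vector_derivative[OF bounded_linear_matrix_vector_mult_left] der t)
      then have "((\<lambda>t. c * f t) has_real_derivative c * (v \<bullet> (D t *v v))) (at t)"
        by (rule DERIV_cmult)
      then have "((\<lambda>t. arccos (c * f t)) has_real_derivative
          inverse (- sqrt (1 - (c * f t)\<^sup>2)) * (c * (v \<bullet> (D t *v v)))) (at t)"
        using cf[OF t01] by (intro DERIV_chain2[OF DERIV_arccos]) auto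
      then show "((\<lambda>t. arccos (c * f t)) has_vector_derivative
          inverse (- sqrt (1 - (c * f t)\<^sup>2)) * (c * (v \<bullet> (D t *v v)))) (at t)"
        by (simp add: has_real_derivative_iff_has_vector_derivative)
      have tan: "(D t *v x) \<bullet> (g t *v w) + (g t *v x) \<bullet> (D t *v w) = 0" for x w
        using t orth by (intro orthogonal_matrix_tangent[where U = "{0<..<1}"] der) auto
      have "(D t *v v) \<bullet> (g t *v v) = 0"
        using tan[of v v] by (simp add: inner_commute)
      then have "\<bar>v \<bullet> (D t *v v)\<bar> \<le> sqrt (1 - (f t)\<^sup>2) * norm (D t *v v)"
        unfolding f_def by (rule abs_inner_tangent_le[OF v unit[OF t01]])
      also have "\<dots> \<le> sqrt (1 - (f t)\<^sup>2) * mat_norm (D t)"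
        using f_le[OF t01] by (intro mult_left_mono norm_orthogonal_tangent_mult_le[OF orth[OF t01] tan v])
          (auto simp: abs_square_le_1)
      \<comment> \<open>Passing from \<open>f t\<close> to \<open>c * f t\<close> enlarges the root
        to the one in the denominator of the derivative of \<open>arccos\<close>, so that the two
        cancel.\<close>
      also have "\<dots> \<le> sqrt (1 - (c * f t)\<^sup>2) * mat_norm (D t)"
      proof (intro mult_right_mono real_sqrt_le_mono)
        have "c\<^sup>2 * (f t)\<^sup>2 \<le> 1 * (f t)\<^sup>2"
          using c by (intro mult_right_mono) (auto simp: power_le_one)
        then show "1 - (f t)\<^sup>2 \<le> 1 - (c * f t)\<^sup>2" by (simp add: power_mult_distrib)
      qed (simp add: mat_norm_eq)
      finally have "c * \<bar>v \<bullet> (D t *v v)\<bar> \<le> 1 * (sqrt (1 - (c * f t)\<^sup>2) * mat_norm (D t))"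
        using c by (intro mult_mono) auto
      moreover have "sqrt (1 - (c * f t)\<^sup>2) > 0"
        using cf[OF t01] by (simp add: abs_square_less_1)
      ultimately show "norm (inverse (- sqrt (1 - (c * f t)\<^sup>2)) * (c * (v \<bullet> (D t *v v))))
          \<le> mat_norm (D t)"
        using c by (simp add: abs_mult field_simps)
    qed
    moreover have "f 0 = 1"
      using v g by (simp add: f_def dot_square_norm)
    ultimately show ?thesis by simp
  qed
  \<comment> \<open>\<open>arccos\<close> is continuous up to 1, so \<open>c\<close> may tend to 1
    from below.\<close>
  have "((\<lambda>c. arccos (c * f 1) - arccos c) \<longlongrightarrow> arccos (1 * f 1) - arccos 1) (at_left 1)"
  proof -
    have 1: "continuous_on {0..1} (\<lambda>c. arccos (c * f 1) - arccos c)"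
    proof (intro continuous_intros ballI conjI)
      fix c :: real assume "c \<in> {0..1}"
      then have "\<bar>c * f 1\<bar> \<le> 1 * 1"
        unfolding abs_mult using f_le[of 1] by (intro mult_mono) auto
      then show "- 1 \<le> c * f 1" "c * f 1 \<le> 1" by auto
    qed auto
    then have "((\<lambda>c. arccos (c * f 1) - arccos c) \<longlongrightarrow> arccos (1 * f 1) - arccos 1)
        (at 1 within {0..1})"
      unfolding continuous_on_def by (rule bspec) simp
    then show ?thesis by (simp add: at_within_Icc_at_left)
  qed
  moreover have "eventually (\<lambda>c. arccos (c * f 1) - arccos c \<le> L) (at_left 1)"
    by (rule eventually_mono[OF eventually_at_left_real[of 0 1]]) (auto intro: approx)
  ultimately have "arccos (1 * f 1) - arccos 1 \<le> L"
    by (rule tendsto_upperbound) simp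
  then show ?thesis using g by (simp add: f_def)
qed

section \<open>Estimates on closed geodesic balls\<close>

text \<open>The distance is an infimum, which supplies curves of length below any larger radius
  \<open>r'\<close>; the slack is removed afterwards by \<open>dense_ge\<close>.\<close>

lemma closed_geodesic_ball_length:
  fixes R :: "real^'n^'n"
  assumes "R \<in> closed_geodesic_ball r" "r < r'"
  obtains L where "L \<in> curve_lengths (mat 1) R" "L < r'"
proof -
  have "Inf (ereal ` curve_lengths (mat 1) R) < ereal r'"
    using assms unfolding closed_geodesic_ball_def geodesic_dist_def
    by (auto intro: le_less_trans)
  then show ?thesis using that by (auto simp: Inf_less_iff)
qed

lemma norm_skew_part_le_of_ball:
  fixes R :: "real^'n^'n"
  assumes "R \<in> closed_geodesic_ball r"
  shows "norm (R - transpose R) \<le> 2 * sqrt 2 * r"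
proof -
  have "norm (R - transpose R) / (2 * sqrt 2) \<le> r'" if "r < r'" for r'
  proof -
    obtain L where "L \<in> curve_lengths (mat 1) R" "L < r'"
      by (rule closed_geodesic_ball_length[OF assms \<open>r < r'\<close>])
    moreover from this have "norm (R - transpose R) / (2 * sqrt 2) \<le> L"
      using norm_skew_part_le_curve_length[of L R]
      by (simp add: pos_divide_le_eq mult.commute)
    ultimately show ?thesis by linarith
  qed
  then have "norm (R - transpose R) / (2 * sqrt 2) \<le> r"
    by (rule dense_ge)
  then show ?thesis by (simp add: field_simps)
qed

text \<open>\<open>R\<close> turns every unit vector through an angle of at most \<open>r\<close>,
  and the cosine decreases on \<open>[0, pi]\<close>. General vectors follow by scaling.\<close>

lemma inner_ge_cos_of_ball:
  fixes R :: "real^'n^'n"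
  assumes R: "R \<in> closed_geodesic_ball r" and r: "0 \<le> r" "r \<le> pi"
  shows "cos r * (v \<bullet> v) \<le> v \<bullet> (R *v v)"
proof -
  have unit: "cos r \<le> u \<bullet> (R *v u)" if u: "norm u = 1" for u
  proof -
    have "arccos (u \<bullet> (R *v u)) \<le> r'" if "r < r'" for r'
    proof -
      obtain L where "L \<in> curve_lengths (mat 1) R" "L < r'"
        by (rule closed_geodesic_ball_length[OF R \<open>r < r'\<close>])
      then show ?thesis using arccos_le_curve_length[OF _ u] by fastforce
    qed
    then have le: "arccos (u \<bullet> (R *v u)) \<le> r" by (rule dense_ge)
    have "orthogonal_matrix R" using R by (simp add: closed_geodesic_ball_def SO_def)
    then have "norm (R *v u) = 1"
      using orthogonal_matrix_inner[of R u u] u by (simp add: norm_eq_sqrt_inner)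
    then have "\<bar>u \<bullet> (R *v u)\<bar> \<le> 1"
      using Cauchy_Schwarz_ineq2[of u "R *v u"] u by simp
    then have b: "-1 \<le> u \<bullet> (R *v u)" "u \<bullet> (R *v u) \<le> 1" by auto
    have "cos r \<le> cos (arccos (u \<bullet> (R *v u)))"
      using le r arccos_lbound[OF b] by (intro cos_monotone_0_pi_le) auto
    then show ?thesis using b by simp
  qed
  show ?thesis
  proof (cases "v = 0")
    case False
    define u where "u = v /\<^sub>R norm v"
    have v: "v = norm v *\<^sub>R u" and u: "norm u = 1" using False by (auto simp: u_def)
    have "v \<bullet> (R *v v) = (norm v)\<^sup>2 * (u \<bullet> (R *v u))"
      by (subst (1 2) v) (simp add: matrix_vector_mult_scaleR power2_eq_square)
    moreover have "(norm v)\<^sup>2 * cos r \<le> (norm v)\<^sup>2 * (u \<bullet> (R *v u))"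
      by (intro mult_left_mono unit u) auto
    ultimately show ?thesis by (simp add: dot_square_norm mult.commute)
  qed simp
qed

section \<open>The influence function and its Lipschitz constant\<close>

lemma geodesic_dist_nonneg: "0 \<le> geodesic_dist X Y"
proof -
  have "0 \<le> L" if "L \<in> curve_lengths X Y" for L
    using that unfolding curve_lengths_def
    by clarify (erule has_integral_nonneg, simp add: mat_norm_eq)
  then show ?thesis unfolding geodesic_dist_def by (intro Inf_greatest) auto
qed

text \<open>The support is the closure of a subset of the closed domain. Hence the assumptions on
  the profile apply at all radii up to \<open>\<beta>\<close>.\<close>

lemma influence_profile_support_subset:
  assumes "influence_profile m \<beta> Itilde"
  shows "{0..\<beta>} \<subseteq> {0..real (m div 2) * pi}"
proof -
  have "closure {r\<in>{0..real (m div 2) * pi}. Itilde r \<noteq> 0} = {0..\<beta>}"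
    using assms by (auto simp: influence_profile_def Let_def)
  from this[symmetric] show ?thesis
    by (simp only:) (intro closure_minimal, auto)
qed

lemma influence_profile_nonneg:
  assumes "influence_profile m \<beta> Itilde" "0 \<le> r" "r \<le> \<beta>"
  shows "0 \<le> Itilde r"
  using assms influence_profile_support_subset[OF assms(1)]
  by (auto simp: influence_profile_def Let_def)

text \<open>On the ball the distance lies between 0 and \<open>\<gamma>\<close>, so
  \<open>real_of_ereal\<close> keeps its value and the profile is monotone on the radii
  concerned.\<close>

lemma influence_ge_of_ball:
  fixes R :: "real^'n^'n"
  assumes prof: "influence_profile m \<beta> Itilde" and \<gamma>: "0 \<le> \<gamma>" "\<gamma> \<le> \<beta>"
    and R: "R \<in> closed_geodesic_ball \<gamma>"
  shows "Itilde \<gamma> \<le> influence Itilde R"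
proof -
  have mono: "antimono_on {0..real (m div 2) * pi} Itilde"
    using prof by (simp add: influence_profile_def Let_def)
  have le: "geodesic_dist (mat 1) R \<le> ereal \<gamma>"
    using R by (simp add: closed_geodesic_ball_def)
  then obtain r where r: "geodesic_dist (mat 1) R = ereal r"
    using geodesic_dist_nonneg[of "mat 1" R] by (cases "geodesic_dist (mat 1) R") auto
  have "0 \<le> r" "r \<le> \<gamma>"
    using r le geodesic_dist_nonneg[of "mat 1" R] by simp_all
  then have "r \<in> {0..\<beta>}" "\<gamma> \<in> {0..\<beta>}"
    using \<gamma> by auto
  then show ?thesis
    using \<open>r \<le> \<gamma>\<close> mono influence_profile_support_subset[OF prof]
    unfolding influence_def r monotone_on_def by auto
qed

lemma Lip_star_bound:
  fixes I :: "real^'n^'n \<Rightarrow> real"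
  assumes "Lip_star I = ereal L" and X: "X \<in> SO" and Y: "Y \<in> SO"
  shows "\<bar>I X - I Y\<bar> \<le> L * mat_norm (X - Y)"
proof (cases "X = Y")
  case False
  have "ereal (\<bar>I X - I Y\<bar> / mat_norm (X - Y)) \<le> Lip_star I"
    unfolding Lip_star_def using X Y False by (intro Sup_upper) blast
  then show ?thesis using assms False by (simp add: mat_norm_eq field_simps)
qed (simp add: mat_norm_eq)

text \<open>Every quotient in the supremum is nonnegative. The supremum is
  \<open>-\<infinity>\<close> exactly when there is no quotient, that is, when \<open>SO\<close> has
  a single point.\<close>

lemma Lip_star_nonneg:
  fixes I :: "real^'n^'n \<Rightarrow> real"
  assumes "Lip_star I \<noteq> -\<infinity>"
  shows "0 \<le> Lip_star I"
proof -
  obtain X Y :: "real^'n^'n" where "X \<in> SO" "Y \<in> SO" "X \<noteq> Y"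
  proof (rule ccontr)
    assume "\<not> thesis"
    with that have empty: "{ereal (\<bar>I X - I Y\<bar> / mat_norm (X - Y)) | X Y. X \<in> SO \<and> Y \<in> SO \<and> X \<noteq> Y} = {}"
      by auto
    show False using assms unfolding Lip_star_def empty by (simp add: bot_ereal_def)
  qed
  then have "ereal (\<bar>I X - I Y\<bar> / mat_norm (X - Y)) \<le> Lip_star I"
    unfolding Lip_star_def by (intro Sup_upper) blast
  moreover have "0 \<le> ereal (\<bar>I X - I Y\<bar> / mat_norm (X - Y))"
    by (simp add: mat_norm_eq)
  ultimately show ?thesis by (rule order_trans[rotated])
qed

section \<open>Energy estimate for one component\<close>

text \<open>With the mean influences of two solutions as \<open>p\<close> and \<open>q\<close>, the
  left side is the derivative of \<open>(mat_norm (X - Y))\<^sup>2\<close>; hence the factors 2 on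
  the right.\<close>

lemma winfree_field_dissipative:
  fixes A X Y :: "real^'n^'n"
  assumes A: "A \<in> so" and X: "X \<in> closed_geodesic_ball \<gamma>" and Y: "Y \<in> closed_geodesic_ball \<gamma>"
    and \<gamma>: "0 \<le> \<gamma>" "\<gamma> \<le> pi / 2" and \<kappa>: "0 \<le> \<kappa>" and m: "0 \<le> m" "m \<le> p" and e: "\<bar>p - q\<bar> \<le> e"
  defines "F \<equiv> \<lambda>c Z. A ** Z + (\<kappa> / 2 * c) *\<^sub>R (mat 1 - Z ** Z)"
  shows "(X - Y) \<bullet> (F p X - F q Y)
    \<le> - 2 * (\<kappa> * cos \<gamma> * m) * (mat_norm (X - Y))\<^sup>2 + 2 * (\<kappa> * \<gamma> * e) * mat_norm (X - Y)"
proof -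
  define D where "D = X - Y"
  \<comment> \<open>The difference of the squares, factored as \<open>X ** D + D ** Y\<close>, gets
    the weight \<open>p\<close>, and the change of influence multiplies only
    \<open>mat 1 - Y ** Y\<close>.\<close>
  have split: "F p X - F q Y = A ** D - (\<kappa> / 2 * p) *\<^sub>R (X ** D + D ** Y)
      + (\<kappa> / 2 * (p - q)) *\<^sub>R (mat 1 - Y ** Y)"
    by (simp add: F_def D_def matrix_mult_diff_distrib algebra_simps diff_divide_distrib)
  have skew: "D \<bullet> (A ** D) = 0"
    using A by (intro inner_skew_mult) (simp add: so_def)
  have c: "cos \<gamma> * (D \<bullet> D) \<le> D \<bullet> (X ** D)" "cos \<gamma> * (D \<bullet> D) \<le> D \<bullet> (D ** Y)"
    using \<gamma> by (auto intro!: inner_mult_left_ge inner_mult_right_ge inner_ge_cos_of_ball X Y)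
  have cos: "0 \<le> cos \<gamma>" using \<gamma> by (intro cos_ge_zero) auto
  \<comment> \<open>As \<open>cos \<gamma>\<close> is nonnegative, both factors on the right can be
    lowered to their bounds at once.\<close>
  have "\<kappa> / 2 * m * (2 * (cos \<gamma> * (D \<bullet> D))) \<le> \<kappa> / 2 * p * (D \<bullet> (X ** D + D ** Y))"
    using c \<kappa> m cos by (intro mult_mono) (auto simp: inner_add_right)
  moreover have "\<kappa> / 2 * (p - q) * (D \<bullet> (mat 1 - Y ** Y)) \<le> \<kappa> / 2 * e * (norm D * (2 * sqrt 2 * \<gamma>))"
  proof -
    have "orthogonal_matrix Y" using Y by (simp add: closed_geodesic_ball_def SO_def)
    then have "norm (mat 1 - Y ** Y) \<le> 2 * sqrt 2 * \<gamma>"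
      using norm_skew_part_le_of_ball[OF Y] by (simp add: norm_mat_1_minus_square)
    then have "\<bar>D \<bullet> (mat 1 - Y ** Y)\<bar> \<le> norm D * (2 * sqrt 2 * \<gamma>)"
      by (intro order_trans[OF Cauchy_Schwarz_ineq2] mult_left_mono) auto
    then have "\<kappa> / 2 * \<bar>p - q\<bar> * \<bar>D \<bullet> (mat 1 - Y ** Y)\<bar> \<le> \<kappa> / 2 * e * (norm D * (2 * sqrt 2 * \<gamma>))"
      using e \<kappa> by (intro mult_mono) auto
    moreover have "\<kappa> / 2 * (p - q) * (D \<bullet> (mat 1 - Y ** Y))
        \<le> \<bar>\<kappa> / 2 * (p - q) * (D \<bullet> (mat 1 - Y ** Y))\<bar>"
      by (rule abs_ge_self)
    ultimately show ?thesis using \<kappa> by (simp add: abs_mult)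
  qed
  ultimately have "D \<bullet> (F p X - F q Y)
      \<le> - (\<kappa> / 2 * m * (2 * (cos \<gamma> * (D \<bullet> D)))) + \<kappa> / 2 * e * (norm D * (2 * sqrt 2 * \<gamma>))"
    unfolding split by (simp add: inner_add_right inner_diff_right skew)
  also have "\<kappa> / 2 * m * (2 * (cos \<gamma> * (D \<bullet> D))) = 2 * (\<kappa> * cos \<gamma> * m) * (mat_norm D)\<^sup>2"
    by (simp add: mat_norm_eq power_divide dot_square_norm)
  \<comment> \<open>The factor \<open>sqrt 2\<close> of the ball estimate and the one between
    \<open>norm D\<close> and \<open>mat_norm D\<close> combine to 2.\<close>
  also have "\<kappa> / 2 * e * (norm D * (2 * sqrt 2 * \<gamma>)) = 2 * (\<kappa> * \<gamma> * e) * mat_norm D"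
  proof -
    have "norm D = sqrt 2 * mat_norm D" by (simp add: mat_norm_eq)
    then have "norm D * sqrt 2 = 2 * mat_norm D" by simp
    then show ?thesis by (simp add: mult.left_commute mult.commute)
  qed
  finally show ?thesis by (simp add: D_def)
qed

section \<open>A Gronwall estimate for sums of square roots\<close>

text \<open>The square roots need not be differentiable at zeros of \<open>Q i\<close>, so they are replaced by
  \<open>sqrt (Q i + \<epsilon>)\<close>; the error \<open>c\<close> this causes vanishes with \<open>\<epsilon>\<close>.\<close>

lemma sum_sqrt_gronwall:
  fixes Q Q' :: "'i \<Rightarrow> real \<Rightarrow> real"
  assumes fin: "finite J"
    and cont: "\<And>i. i \<in> J \<Longrightarrow> continuous_on {0..} (Q i)"
    and nonneg: "\<And>i t. i \<in> J \<Longrightarrow> 0 \<le> t \<Longrightarrow> 0 \<le> Q i t"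
    and der: "\<And>i t. i \<in> J \<Longrightarrow> 0 < t \<Longrightarrow> (Q i has_real_derivative Q' i t) (at t)"
    and le: "\<And>i t. i \<in> J \<Longrightarrow> 0 < t \<Longrightarrow>
      Q' i t \<le> - 2 * a * Q i t + 2 * (b / card J * (\<Sum>j\<in>J. sqrt (Q j t))) * sqrt (Q i t)"
    and ab: "0 \<le> a" "0 \<le> b" "b < a" and t: "0 \<le> t"
  shows "(\<Sum>i\<in>J. sqrt (Q i t)) \<le> exp (- (a - b) * t) * (\<Sum>i\<in>J. sqrt (Q i 0))"
proof -
  define rate where "rate = a - b"
  have rate: "rate > 0" using ab by (simp add: rate_def)
  have reg: "(\<Sum>i\<in>J. sqrt (Q i t + \<epsilon>))
      \<le> exp (- rate * t) * (\<Sum>i\<in>J. sqrt (Q i 0 + \<epsilon>)) + card J * a * sqrt \<epsilon> / rate"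
    if \<epsilon>: "0 < \<epsilon>" for \<epsilon>
  proof -
    define V where "V s = (\<Sum>i\<in>J. sqrt (Q i s + \<epsilon>))" for s
    define V' where "V' s = (\<Sum>i\<in>J. Q' i s / (2 * sqrt (Q i s + \<epsilon>)))" for s
    \<comment> \<open>The regularization costs at most \<open>a * sqrt \<epsilon>\<close> per index,
      in total \<open>rate * c\<close>; thus \<open>c\<close> is the equilibrium of the differential
      inequality for \<open>V\<close>.\<close>
    define c where "c = card J * a * sqrt \<epsilon> / rate"
    have V_der: "(V has_real_derivative V' s) (at s)" if s: "0 < s" for s
    proof -
      have "((\<lambda>s. sqrt (Q i s + \<epsilon>)) has_real_derivative Q' i s / (2 * sqrt (Q i s + \<epsilon>))) (at s)"
        if i: "i \<in> J" for i
      proof -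
        have "0 < Q i s + \<epsilon>" using nonneg[OF i, of s] s \<epsilon> by simp
        then show ?thesis
          by (auto intro!: derivative_eq_intros der[OF i s] simp: field_simps)
      qed
      then show ?thesis unfolding V_def V'_def by (intro DERIV_sum) auto
    qed
    have V'_le: "V' s \<le> - rate * (V s - c)" if s: "0 < s" for s
    proof (cases "J = {}")
      case True
      then show ?thesis by (simp add: V_def V'_def c_def)
    next
      case False
      define U where "U = (\<Sum>j\<in>J. sqrt (Q j s))"
      have U: "0 \<le> U" unfolding U_def using nonneg s by (intro sum_nonneg) auto
      have "Q' i s / (2 * sqrt (Q i s + \<epsilon>)) \<le> - a * sqrt (Q i s + \<epsilon>) + a * sqrt \<epsilon> + b / card J * U"
        if i: "i \<in> J" for i
      proof -
        define y where "y = sqrt (Q i s + \<epsilon>)"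
        have q: "0 \<le> Q i s" using nonneg[OF i] s by simp
        have y: "y > 0" "Q i s = y\<^sup>2 - \<epsilon>" "sqrt (Q i s) \<le> y" "sqrt \<epsilon> \<le> y"
          using q \<epsilon> by (auto simp: y_def)
        \<comment> \<open>After division by \<open>y\<close> this bounds the error
          \<open>\<epsilon> / y\<close> by \<open>sqrt \<epsilon>\<close>, uniformly in
          \<open>y\<close>.\<close>
        have "\<epsilon> = sqrt \<epsilon> * sqrt \<epsilon>" using \<epsilon> by simp
        also have "\<dots> \<le> sqrt \<epsilon> * y" using y \<epsilon> by (intro mult_left_mono) auto
        finally have "a * (y\<^sup>2 - sqrt \<epsilon> * y) \<le> a * Q i s"
          using ab y by (intro mult_left_mono) auto
        moreover define w where "w = b / card J * U"
        then have "w * sqrt (Q i s) \<le> w * y"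
          using ab U y by (intro mult_left_mono) auto
        moreover have "Q' i s \<le> - 2 * a * Q i s + 2 * w * sqrt (Q i s)"
          using le[OF i s] by (simp add: w_def U_def)
        ultimately have "Q' i s \<le> (- a * y + a * sqrt \<epsilon> + w) * (2 * y)"
          by (simp add: algebra_simps power2_eq_square)
        then show ?thesis using y(1) by (simp add: y_def[symmetric] w_def pos_divide_le_eq)
      qed
      then have "V' s \<le> (\<Sum>i\<in>J. - a * sqrt (Q i s + \<epsilon>) + a * sqrt \<epsilon> + b / card J * U)"
        unfolding V'_def by (rule sum_mono)
      \<comment> \<open>Summation over the nonempty \<open>J\<close> cancels the averaging factor
        \<open>1 / card J\<close>.\<close>
      also have "\<dots> = - a * V s + card J * a * sqrt \<epsilon> + b * U"
        using False fin by (simp add: sum.distrib V_def sum_distrib_left sum_subtractf sum_negf)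
      also have "b * U \<le> b * V s"
        unfolding U_def V_def using ab \<epsilon> by (intro mult_left_mono sum_mono) auto
      also have "- a * V s + card J * a * sqrt \<epsilon> + b * V s = - rate * (V s - c)"
        using rate by (simp add: c_def field_simps) (simp add: rate_def algebra_simps)
      finally show ?thesis by simp
    qed
    \<comment> \<open>The integrating factor \<open>exp (rate * s)\<close> turns
      \<open>V'_le\<close> into monotonicity; at time 0 only continuity is available.\<close>
    have "exp (rate * t) * (V t - c) \<le> exp (rate * 0) * (V 0 - c)"
    proof (rule DERIV_nonpos_imp_decreasing_open[OF t])
      fix s assume s: "0 < s" "s < t"
      have "((\<lambda>s. exp (rate * s) * (V s - c)) has_real_derivative
          exp (rate * s) * (rate * (V s - c) + V' s)) (at s)"
        by (auto intro!: derivative_eq_intros V_der s simp: algebra_simps)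
      moreover have "exp (rate * s) * (rate * (V s - c) + V' s) \<le> 0"
        using V'_le[OF s(1)] by (intro mult_nonneg_nonpos) auto
      ultimately show "\<exists>y. ((\<lambda>s. exp (rate * s) * (V s - c)) has_real_derivative y) (at s) \<and> y \<le> 0"
        by blast
    next
      have "continuous_on {0..t} (Q i)" if "i \<in> J" for i
        using cont[OF that] by (rule continuous_on_subset) auto
      then show "continuous_on {0..t} (\<lambda>s. exp (rate * s) * (V s - c))"
        unfolding V_def by (intro continuous_intros) auto
    qed
    then have "exp (- rate * t) * (exp (rate * t) * (V t - c)) \<le> exp (- rate * t) * (V 0 - c)"
      by (intro mult_left_mono) auto
    then have "V t - c \<le> exp (- rate * t) * (V 0 - c)"
      by (simp flip: mult.assoc exp_add)
    moreover have "0 \<le> exp (- rate * t) * c"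
      using rate ab \<epsilon> by (simp add: c_def)
    ultimately show ?thesis
      by (simp add: V_def c_def algebra_simps)
  qed
  have lim1: "((\<lambda>\<epsilon>. \<Sum>i\<in>J. sqrt (Q i t + \<epsilon>)) \<longlongrightarrow> (\<Sum>i\<in>J. sqrt (Q i t + 0))) (at_right 0)"
    by (intro tendsto_intros)
  have lim2: "((\<lambda>\<epsilon>. exp (- rate * t) * (\<Sum>i\<in>J. sqrt (Q i 0 + \<epsilon>)) + card J * a * sqrt \<epsilon> / rate) \<longlongrightarrow>
      exp (- rate * t) * (\<Sum>i\<in>J. sqrt (Q i 0 + 0)) + card J * a * sqrt 0 / rate) (at_right 0)"
    using rate by (intro tendsto_intros) auto
  have "(\<Sum>i\<in>J. sqrt (Q i t + 0))
      \<le> exp (- rate * t) * (\<Sum>i\<in>J. sqrt (Q i 0 + 0)) + card J * a * sqrt 0 / rate"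
    by (rule tendsto_le[OF _ lim2 lim1]) (use reg in \<open>auto simp: eventually_at_filter\<close>)
  then show ?thesis by (simp add: rate_def)
qed

section \<open>Contraction between two solutions in the ball\<close>

theorem theorem3p1:
  fixes N :: nat
    and \<Omega> :: "nat \<Rightarrow> real^'n^'n"
    and R0 S0 :: "nat \<Rightarrow> real^'n^'n"
    and R S :: "nat \<Rightarrow> real \<Rightarrow> real^'n^'n"
    and Itilde :: "real \<Rightarrow> real"
    and \<kappa> \<beta> \<gamma> lambda1 :: real
  assumes "\<And>i. i \<in> {1..N} \<Longrightarrow> \<Omega> i \<in> so"
    and "\<kappa> > 0"
    and "0 < \<beta>" "\<beta> < pi / 2"
    and "influence_profile CARD('n) \<beta> Itilde"
    and "0 < \<gamma>" "\<gamma> < \<beta>"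
    and "ereal lambda1 = ereal \<kappa> * (ereal (cos \<gamma> * Itilde \<gamma>)
           - ereal \<gamma> * Lip_star (influence Itilde :: real^'n^'n \<Rightarrow> real))"
    and "lambda1 > 0"
    and "\<And>i. i \<in> {1..N} \<Longrightarrow> R0 i \<in> SO"
    and "\<And>i. i \<in> {1..N} \<Longrightarrow> S0 i \<in> SO"
    and "winfree_solution N \<Omega> \<kappa> (influence Itilde) R0 R"
    and "winfree_solution N \<Omega> \<kappa> (influence Itilde) S0 S"
    and "\<And>i t. i \<in> {1..N} \<Longrightarrow> t \<ge> 0 \<Longrightarrow> R i t \<in> closed_geodesic_ball \<gamma>"
    and "\<And>i t. i \<in> {1..N} \<Longrightarrow> t \<ge> 0 \<Longrightarrow> S i t \<in> closed_geodesic_ball \<gamma>"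
  shows "\<forall>t\<ge>0. ell1_norm N (\<lambda>i. R i t - S i t)
           \<le> exp (- lambda1 * t) * ell1_norm N (\<lambda>i. R0 i - S0 i)"
proof (intro allI impI)
  fix t :: real assume t: "0 \<le> t"
  let ?I = "influence Itilde :: real^'n^'n \<Rightarrow> real"
  let ?D = "\<lambda>i t. R i t - S i t"
  let ?c = "\<lambda>Z :: nat \<Rightarrow> real \<Rightarrow> real^'n^'n. \<lambda>t. 1 / real N * (\<Sum>j=1..N. ?I (Z j t))"
  let ?F = "\<lambda>i c Z. \<Omega> i ** Z + (\<kappa> / 2 * c) *\<^sub>R (mat 1 - Z ** Z)"
  note \<Omega> = assms(1) and \<kappa> = assms(2) and prof = assms(5) and \<gamma> = assms(6,7)
    and lam_eq = assms(8) and solR = assms(12) and solS = assms(13)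
    and ballR = assms(14) and ballS = assms(15)
  have \<gamma>2: "0 \<le> \<gamma>" "\<gamma> \<le> pi / 2" "\<gamma> \<le> \<beta>" using \<gamma> assms(4) by auto
  \<comment> \<open>An infinite Lipschitz constant would make the right side of
    \<open>lam_eq\<close> infinite, as \<open>\<kappa>\<close> and \<open>\<gamma>\<close> are
    positive.\<close>
  obtain L where L: "Lip_star ?I = ereal L"
    using lam_eq \<kappa> \<gamma> by (cases "Lip_star ?I") auto
  have L0: "0 \<le> L" using Lip_star_nonneg[of ?I] L by simp
  \<comment> \<open>\<open>a\<close> is the contraction rate from the quadratic terms,
    \<open>b\<close> the growth rate from the difference of the mean influences.\<close>
  define a where "a = \<kappa> * cos \<gamma> * Itilde \<gamma>"
  define b where "b = \<kappa> * \<gamma> * L"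
  have lam: "lambda1 = a - b"
    using lam_eq by (simp add: L a_def b_def algebra_simps)
  have I0: "0 \<le> Itilde \<gamma>" by (rule influence_profile_nonneg[OF prof \<gamma>2(1,3)])
  have cos: "0 \<le> cos \<gamma>" using \<gamma>2 by (intro cos_ge_zero) auto
  have SO: "R i s \<in> SO" "S i s \<in> SO" if "i \<in> {1..N}" "0 \<le> s" for i s
    using ballR[OF that] ballS[OF that] by (auto simp: closed_geodesic_ball_def)
  \<comment> \<open>The index \<open>i\<close> witnesses that \<open>N\<close> is positive, so that
    the mean is a true average.\<close>
  have mean_ge: "Itilde \<gamma> \<le> ?c R s" if "i \<in> {1..N}" "0 \<le> s" for i s
  proof -
    have "(\<Sum>j=1..N. Itilde \<gamma>) \<le> (\<Sum>j=1..N. ?I (R j s))"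
      using that by (intro sum_mono influence_ge_of_ball[OF prof \<gamma>2(1,3)] ballR) auto
    then show ?thesis using that by (simp add: field_simps)
  qed
  \<comment> \<open>For \<open>N = 0\<close> both sides are 0, since division by zero gives
    0.\<close>
  have mean_diff: "\<bar>?c R s - ?c S s\<bar> \<le> L / N * (\<Sum>j=1..N. mat_norm (?D j s))" if s: "0 \<le> s" for s
  proof -
    have "\<bar>\<Sum>j=1..N. ?I (R j s) - ?I (S j s)\<bar> \<le> (\<Sum>j=1..N. L * mat_norm (?D j s))"
      by (intro order_trans[OF sum_abs] sum_mono Lip_star_bound[OF L] SO s)
    then have "1 / N * \<bar>\<Sum>j=1..N. ?I (R j s) - ?I (S j s)\<bar>
        \<le> 1 / N * (\<Sum>j=1..N. L * mat_norm (?D j s))"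
      by (intro mult_left_mono) auto
    moreover have "?c R s - ?c S s = 1 / N * (\<Sum>j=1..N. ?I (R j s) - ?I (S j s))"
      by (simp add: sum_subtractf diff_divide_distrib)
    ultimately show ?thesis
      by (simp only: abs_mult sum_distrib_left[symmetric]) simp
  qed
  \<comment> \<open>Each norm is written as the root of its square, which is differentiable even
    where the two solutions meet.\<close>
  have "(\<Sum>i=1..N. sqrt ((mat_norm (?D i t))\<^sup>2))
      \<le> exp (- (a - b) * t) * (\<Sum>i=1..N. sqrt ((mat_norm (?D i 0))\<^sup>2))"
  proof (rule sum_sqrt_gronwall[where Q' = "\<lambda>i s. ?D i s \<bullet> (?F i (?c R s) (R i s) - ?F i (?c S s) (S i s))"])
    show "continuous_on {0..} (\<lambda>s. (mat_norm (?D i s))\<^sup>2)" if "i \<in> {1..N}" for i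
      using solR solS that unfolding mat_norm_eq winfree_solution_def
      by (intro continuous_intros) auto
  next
    fix i s assume i: "i \<in> {1..N}" and s: "0 < (s::real)"
    have "(?D i has_vector_derivative ?F i (?c R s) (R i s) - ?F i (?c S s) (S i s)) (at s)"
      using solR solS i s unfolding winfree_solution_def
      by (intro has_vector_derivative_diff) auto
    from bounded_bilinear.has_vector_derivative[OF bounded_bilinear_inner this this]
    have "((\<lambda>s. ?D i s \<bullet> ?D i s) has_real_derivative
        2 * (?D i s \<bullet> (?F i (?c R s) (R i s) - ?F i (?c S s) (S i s)))) (at s)"
      by (simp add: has_real_derivative_iff_has_vector_derivative inner_commute)
    \<comment> \<open>The factor 1/2 leads from the squared Frobenius norm to the square of
      \<open>mat_norm\<close>.\<close>
    from DERIV_cmult[OF this, of "1/2"]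
    show "((\<lambda>s. (mat_norm (?D i s))\<^sup>2) has_real_derivative
        ?D i s \<bullet> (?F i (?c R s) (R i s) - ?F i (?c S s) (S i s))) (at s)"
      by (simp add: mat_norm_eq power_divide dot_square_norm)
    have "?D i s \<bullet> (?F i (?c R s) (R i s) - ?F i (?c S s) (S i s))
        \<le> - 2 * (\<kappa> * cos \<gamma> * Itilde \<gamma>) * (mat_norm (?D i s))\<^sup>2
          + 2 * (\<kappa> * \<gamma> * (L / N * (\<Sum>j=1..N. mat_norm (?D j s)))) * mat_norm (?D i s)"
      using i s \<kappa>
      by (intro winfree_field_dissipative \<Omega> ballR ballS \<gamma>2 I0 mean_ge[of i] mean_diff) auto
    then show "?D i s \<bullet> (?F i (?c R s) (R i s) - ?F i (?c S s) (S i s))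
        \<le> - 2 * a * (mat_norm (?D i s))\<^sup>2
          + 2 * (b / card {1..N} * (\<Sum>j=1..N. sqrt ((mat_norm (?D j s))\<^sup>2)))
            * sqrt ((mat_norm (?D i s))\<^sup>2)"
      by (simp add: a_def b_def mult.assoc)
  qed (use \<kappa> \<gamma>2 L0 I0 cos lam assms(9) t in \<open>auto simp: a_def b_def\<close>)
  moreover have "R i 0 = R0 i" "S i 0 = S0 i" if "i \<in> {1..N}" for i
    using solR solS that by (auto simp: winfree_solution_def)
  ultimately show "ell1_norm N (\<lambda>i. R i t - S i t)
      \<le> exp (- lambda1 * t) * ell1_norm N (\<lambda>i. R0 i - S0 i)"
    by (simp add: ell1_norm_def lam)
qed

end
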